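(* Let $\mathbb{D}$ be the open unit disc in $\mathbb{C}$, let $\psi:\mathbb{D}\to\mathbb{R}$ be a continuous, bounded, subharmonic function, and let $$\Omega=\left\{(z_1,z_2)\in\mathbb{C}^2 : z_1\in\mathbb{D},\ |z_2|<e^{-\psi(z_1)}\right\}.$$ Suppose that $\Omega$ is a smooth bounded pseudoconvex complete Hartogs domain (i.e. the boundary of $\Omega$ is $C^\infty$-smooth). Then $N(\Omega)=\Omega$, where $N(\Omega)$ is the Nebenhülle of $\Omega$. In particular, $\Omega$ does not have nontrivial Nebenhülle.
   Context: The Nebenhülle $N(\Omega)$ of $\Omega$ is the interior of the intersection of all pseudoconvex domains in $\mathbb{C}^2$ that compactly contain $\Omega$ (i.e. that contain the compact set $\overline{\Omega}$). One says that $\Omega$ has nontrivial Nebenhülle if $N(\Omega)\setminus\Omega$ has interior points. The domain $\Omega$ defined by $\psi$ is a bounded complete Hartogs domain, and it is pseudoconvex if and only if $\psi$ is subharmonic on $\mathbb{D}$. Smoothness is an assumption on the boundary of the domain $\Omega$ in $\mathbb{C}^2$, not only on the function $\psi$. *)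

theory Defs
  imports "HOL-Analysis.Analysis"
begin

(* Only continuous real-valued functions occur, so upper semicontinuity and the value
   -infinity are not needed; continuity also makes the circle mean a genuine integral.
   The set U is meant to be open. *)
definition continuous_subharmonic_on :: "complex set \<Rightarrow> (complex \<Rightarrow> real) \<Rightarrow> bool" where
  "continuous_subharmonic_on U u \<longleftrightarrow> continuous_on U u \<and>
     (\<forall>a r. 0 < r \<and> cball a r \<subseteq> U \<longrightarrow>
        u a \<le> integral {0..2 * pi} (\<lambda>t. u (a + of_real r * cis t)) / (2 * pi))"

definition continuous_psh_on :: "(complex \<times> complex) set \<Rightarrow> (complex \<times> complex \<Rightarrow> real) \<Rightarrow> bool" where
  "continuous_psh_on G u \<longleftrightarrow> continuous_on G u \<and>
     (\<forall>a\<^sub>1 a\<^sub>2 b\<^sub>1 b\<^sub>2. continuous_subharmonic_on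
        {\<zeta>. (a\<^sub>1 + \<zeta> * b\<^sub>1, a\<^sub>2 + \<zeta> * b\<^sub>2) \<in> G}
        (\<lambda>\<zeta>. u (a\<^sub>1 + \<zeta> * b\<^sub>1, a\<^sub>2 + \<zeta> * b\<^sub>2)))"

definition compactly_contained :: "'a::topological_space set \<Rightarrow> 'a set \<Rightarrow> bool" where
  "compactly_contained A B \<longleftrightarrow> compact (closure A) \<and> closure A \<subseteq> B"

(* Pseudoconvexity in the sense of a continuous plurisubharmonic exhaustion function;
   no boundary regularity is required. *)
definition pseudoconvex_domain :: "(complex \<times> complex) set \<Rightarrow> bool" where
  "pseudoconvex_domain G \<longleftrightarrow> open G \<and> connected G \<and> G \<noteq> {} \<and>
     (\<exists>\<phi>. continuous_psh_on G \<phi> \<and> (\<forall>c. compactly_contained {z \<in> G. \<phi> z < c} G))"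

definition nebenhuelle :: "(complex \<times> complex) set \<Rightarrow> (complex \<times> complex) set" where
  "nebenhuelle \<Omega> = interior (\<Inter>{G. pseudoconvex_domain G \<and> compactly_contained \<Omega> G})"

definition has_nontrivial_nebenhuelle :: "(complex \<times> complex) set \<Rightarrow> bool" where
  "has_nontrivial_nebenhuelle \<Omega> \<longleftrightarrow> interior (nebenhuelle \<Omega> - \<Omega>) \<noteq> {}"

(* C^n via iterated directional derivatives, which keeps the codomain fixed along the
   recursion; for open U in a finite-dimensional space this is the usual notion. *)
fun times_cont_diff_on ::
  "nat \<Rightarrow> 'a::real_normed_vector set \<Rightarrow> ('a \<Rightarrow> 'b::real_normed_vector) \<Rightarrow> bool" where
  "times_cont_diff_on 0 U f \<longleftrightarrow> continuous_on U f"
| "times_cont_diff_on (Suc n) U f \<longleftrightarrow> (\<forall>x\<in>U. f differentiable (at x)) \<and>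
     (\<forall>v. times_cont_diff_on n U (\<lambda>x. frechet_derivative f (at x) v))"

definition smooth_on :: "'a::real_normed_vector set \<Rightarrow> ('a \<Rightarrow> 'b::real_normed_vector) \<Rightarrow> bool" where
  "smooth_on U f \<longleftrightarrow> (\<forall>n. times_cont_diff_on n U f)"

(* Smoothness is real smoothness: C^2 is regarded as R^4. *)
definition smooth_boundary :: "(complex \<times> complex) set \<Rightarrow> bool" where
  "smooth_boundary \<Omega> \<longleftrightarrow> (\<forall>p \<in> frontier \<Omega>. \<exists>U (\<rho> :: complex \<times> complex \<Rightarrow> real).
     open U \<and> p \<in> U \<and> smooth_on U \<rho> \<and>
     (\<forall>x\<in>U. frechet_derivative \<rho> (at x) \<noteq> (\<lambda>v. 0)) \<and>
     \<Omega> \<inter> U = {x \<in> U. \<rho> x < 0} \<and> frontier \<Omega> \<inter> U = {x \<in> U. \<rho> x = 0})"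

definition hartogs_domain :: "(complex \<Rightarrow> real) \<Rightarrow> (complex \<times> complex) set" where
  "hartogs_domain \<psi> = {(z\<^sub>1, z\<^sub>2). z\<^sub>1 \<in> ball 0 1 \<and> norm z\<^sub>2 < exp (- \<psi> z\<^sub>1)}"

lemma bounded_hartogs_domain:
  assumes "bounded (\<psi> ` ball 0 1)"
  shows "bounded (hartogs_domain \<psi>)"
proof -
  obtain B where B: "\<And>z. z \<in> ball 0 1 \<Longrightarrow> \<bar>\<psi> z\<bar> \<le> B"
    using assms unfolding bounded_iff by (metis imageI real_norm_def)
  have "hartogs_domain \<psi> \<subseteq> ball 0 1 \<times> ball 0 (exp B)"
  proof
    fix z assume "z \<in> hartogs_domain \<psi>"
    then have z: "fst z \<in> ball 0 1" "norm (snd z) < exp (- \<psi> (fst z))"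
      unfolding hartogs_domain_def by auto
    have "exp (- \<psi> (fst z)) \<le> exp B"
      using B[OF z(1)] by (subst exp_le_cancel_iff) linarith
    with z(2) have "norm (snd z) < exp B"
      by (rule less_le_trans)
    with z(1) show "z \<in> ball 0 1 \<times> ball 0 (exp B)"
      by (auto simp: mem_Times_iff)
  qed
  then show ?thesis
    by (rule bounded_subset[OF bounded_Times[OF bounded_ball bounded_ball]])
qed

end

theory Submission
  imports Defs
begin

text \<open>
  The idea is to approximate \<open>\<Omega>\<close> from outside by its own dilates.  For \<open>s < 1 < S\<close> the image
  of \<open>\<Omega>\<close> under the linear map \<open>(z, w) \<mapsto> (z / s, S w)\<close> is again pseudoconvex, and these
  images shrink to the closure of \<open>\<Omega>\<close> as \<open>s\<close> and \<open>S\<close> tend to \<open>1\<close>.  What has to be seen is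
  that each \<open>S > 1\<close> admits an \<open>s < 1\<close>, as close to \<open>1\<close> as desired, for which the dilate
  contains the closure of \<open>\<Omega>\<close>; in other words \<open>(z, w) \<mapsto> (s z, w / S)\<close> must push the
  closure of \<open>\<Omega>\<close> into \<open>\<Omega>\<close>.

  By compactness this is a local question.  Near a point \<open>(z, w)\<close> with \<open>|z| < 1\<close> the factor
  \<open>1 / S\<close> and the continuity of \<open>\<psi>\<close> suffice, for every \<open>s\<close> close to \<open>1\<close>.  The case
  \<open>|z| = 1\<close> is where the smoothness of the boundary enters: there \<open>\<Omega>\<close> lies on one side of
  the real hypersurface \<open>|z| = 1\<close>, which it touches, so both have the same tangent
  space (\<open>radial_derivative_pos\<close>).  The radial field \<open>(z, 0)\<close> is therefore transversal
  to the boundary, and a small radial contraction alone moves the nearby points of the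
  closure into \<open>\<Omega>\<close> (\<open>radial_push_in\<close>).

  Finally, a smooth boundary is nowhere interior to the closure, so the interior of the
  closure of \<open>\<Omega>\<close> is \<open>\<Omega>\<close> (\<open>interior_closure_smooth_boundary\<close>).
\<close>

section \<open>Linear images of pseudoconvex domains\<close>

lemma compactly_contained_continuous_image:
  fixes f :: "'a::topological_space \<Rightarrow> 'b::t2_space"
  assumes "continuous_on UNIV f" "compactly_contained A B"
  shows "compactly_contained (f ` A) (f ` B)"
proof -
  have c: "compact (f ` closure A)"
    using assms continuous_on_subset[of UNIV f "closure A"]
    by (intro compact_continuous_image) (auto simp: compactly_contained_def)
  have "closure (f ` A) \<subseteq> f ` closure A"
    by (rule closure_minimal) (use c closure_subset compact_imp_closed in auto)
  moreover from this c have "compact (closure (f ` A))"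
    using compact_Int_closed[OF c closed_closure, of "f ` A"] by (simp add: Int_absorb1)
  ultimately show ?thesis
    using assms(2) unfolding compactly_contained_def by blast
qed

text \<open>
  A diagonal map carries complex lines to complex lines with the same parameter, so it
  transports a plurisubharmonic exhaustion function to the image.
\<close>

lemma pseudoconvex_domain_diagonal_image:
  fixes c d :: complex
  assumes G: "pseudoconvex_domain G" and nz: "c \<noteq> 0" "d \<noteq> 0"
  defines "f \<equiv> \<lambda>x. (c * fst x, d * snd x)"
  shows "pseudoconvex_domain (f ` G)"
proof -
  define g where "g = (\<lambda>x::complex\<times>complex. (fst x / c, snd x / d))"
  have gf: "g (f x) = x" and fg: "f (g x) = x" for x
    using nz by (auto simp: f_def g_def)
  have cf: "continuous_on A f" and cg: "continuous_on A g" for A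
    using nz by (auto simp: f_def g_def intro!: continuous_intros)
  have mem: "x \<in> f ` A \<longleftrightarrow> g x \<in> A" for x A
    by (metis fg gf image_iff)
  obtain \<phi> where psh: "continuous_psh_on G \<phi>"
    and ex: "\<And>c. compactly_contained {z \<in> G. \<phi> z < c} G"
    using G unfolding pseudoconvex_domain_def by blast
  have "open (g -` G)"
    using G cg by (intro open_vimage) (auto simp: pseudoconvex_domain_def)
  moreover have "g -` G = f ` G"
    by (intro set_eqI) (simp only: mem vimage_eq)
  ultimately have "open (f ` G)"
    by simp
  moreover have "connected (f ` G)" "f ` G \<noteq> {}"
    using G cf unfolding pseudoconvex_domain_def by (auto intro: connected_continuous_image)
  moreover have "continuous_psh_on (f ` G) (\<phi> \<circ> g)"
    unfolding continuous_psh_on_def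
  proof (intro conjI allI)
    have "g ` f ` G = G"
      by (simp add: image_image gf)
    then show "continuous_on (f ` G) (\<phi> \<circ> g)"
      using psh cg by (intro continuous_on_compose) (auto simp: continuous_psh_on_def)
  next
    fix a1 a2 b1 b2
    have line: "g (a1 + \<zeta> * b1, a2 + \<zeta> * b2) = (a1 / c + \<zeta> * (b1 / c), a2 / d + \<zeta> * (b2 / d))" for \<zeta>
      by (simp add: g_def add_divide_distrib)
    show "continuous_subharmonic_on {\<zeta>. (a1 + \<zeta> * b1, a2 + \<zeta> * b2) \<in> f ` G}
            (\<lambda>\<zeta>. (\<phi> \<circ> g) (a1 + \<zeta> * b1, a2 + \<zeta> * b2))"
      using psh unfolding mem o_def line continuous_psh_on_def by blast
  qed
  moreover have "compactly_contained {z \<in> f ` G. (\<phi> \<circ> g) z < k} (f ` G)" for k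
  proof -
    have "{z \<in> f ` G. (\<phi> \<circ> g) z < k} = f ` {z \<in> G. \<phi> z < k}"
      by (auto simp: gf)
    then show ?thesis
      using compactly_contained_continuous_image[OF cf ex] by simp
  qed
  ultimately show ?thesis
    unfolding pseudoconvex_domain_def by blast
qed

section \<open>Domains with smooth boundary\<close>

lemma smooth_on_differentiable:
  "smooth_on U f \<Longrightarrow> x \<in> U \<Longrightarrow> f differentiable at x"
  unfolding smooth_on_def by (metis times_cont_diff_on.simps(2))

lemma smooth_on_continuous_frechet_derivative:
  "smooth_on U f \<Longrightarrow> continuous_on U (\<lambda>x. frechet_derivative f (at x) v)"
  unfolding smooth_on_def by (metis times_cont_diff_on.simps)

lemma has_real_derivative_along_line:
  fixes \<rho> :: "'a::real_normed_vector \<Rightarrow> real"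
  assumes "\<rho> differentiable at (p + t *\<^sub>R v)"
  shows "((\<lambda>t. \<rho> (p + t *\<^sub>R v)) has_real_derivative
           frechet_derivative \<rho> (at (p + t *\<^sub>R v)) v) (at t)"
proof -
  let ?L = "frechet_derivative \<rho> (at (p + t *\<^sub>R v))"
  have L: "(\<rho> has_derivative ?L) (at (p + t *\<^sub>R v))"
    using assms frechet_derivative_works by blast
  have "((\<lambda>t. p + t *\<^sub>R v) has_derivative (\<lambda>h. h *\<^sub>R v)) (at t)"
    by (auto intro!: derivative_eq_intros)
  from diff_chain_at[OF this] L
  have "((\<lambda>t. \<rho> (p + t *\<^sub>R v)) has_derivative (\<lambda>h. ?L (h *\<^sub>R v))) (at t)"
    by (auto simp: o_def)
  moreover have "?L (h *\<^sub>R v) = h * ?L v" for h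
    using linear_scale[OF has_derivative_linear[OF L]] by simp
  ultimately show ?thesis
    by (simp add: has_field_derivative_def mult_commute_abs)
qed

lemma smooth_boundaryE:
  assumes "smooth_boundary \<Omega>" "p \<in> frontier \<Omega>"
  obtains U and \<rho> :: "complex \<times> complex \<Rightarrow> real" where "open U" "p \<in> U" "smooth_on U \<rho>"
    "frechet_derivative \<rho> (at p) \<noteq> (\<lambda>v. 0)"
    "\<rho> p = 0" "\<Omega> \<inter> U = {x \<in> U. \<rho> x < 0}" "\<forall>x \<in> U \<inter> closure \<Omega>. \<rho> x \<le> 0"
proof -
  from bspec[OF assms(1)[unfolded smooth_boundary_def] assms(2)]
  obtain U and \<rho> :: "complex \<times> complex \<Rightarrow> real" where h: "open U \<and> p \<in> U \<and> smooth_on U \<rho> \<and>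
     (\<forall>x\<in>U. frechet_derivative \<rho> (at x) \<noteq> (\<lambda>v. 0)) \<and>
     \<Omega> \<inter> U = {x \<in> U. \<rho> x < 0} \<and> frontier \<Omega> \<inter> U = {x \<in> U. \<rho> x = 0}"
    by (elim exE)
  have "\<rho> x \<le> 0" if "x \<in> U" "x \<in> closure \<Omega>" for x
  proof -
    have "x \<in> \<Omega> \<inter> U \<or> x \<in> frontier \<Omega> \<inter> U"
      using that closure_Un_frontier[of \<Omega>] by auto
    then show ?thesis
      using h by auto
  qed
  moreover have "\<rho> p = 0"
  proof -
    have "p \<in> frontier \<Omega> \<inter> U"
      by (intro IntI assms(2)) (use h in blast)
    then show ?thesis
      using h by simp
  qed
  ultimately show thesis
    by (intro that[of U \<rho>]) (use h in simp_all)
qed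

text \<open>
  At a boundary point interior to the closure, the defining function would have a local
  maximum and hence a vanishing derivative.
\<close>

lemma interior_closure_smooth_boundary:
  assumes "open \<Omega>" and sm: "smooth_boundary \<Omega>"
  shows "interior (closure \<Omega>) = \<Omega>"
proof
  show "\<Omega> \<subseteq> interior (closure \<Omega>)"
    using assms(1) closure_subset by (rule interior_maximal[rotated])
  show "interior (closure \<Omega>) \<subseteq> \<Omega>"
  proof (rule subsetI, rule ccontr)
    fix p assume p: "p \<in> interior (closure \<Omega>)" and "p \<notin> \<Omega>"
    then have fr: "p \<in> frontier \<Omega>"
      using assms(1) interior_subset by (auto simp: frontier_def interior_open)
    obtain U and \<rho> :: "complex \<times> complex \<Rightarrow> real" where U: "open U" "p \<in> U" "smooth_on U \<rho>"
      and nz: "frechet_derivative \<rho> (at p) \<noteq> (\<lambda>v. 0)"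
      and zero: "\<rho> p = 0" and nonpos: "\<forall>x \<in> U \<inter> closure \<Omega>. \<rho> x \<le> 0"
      by (rule smooth_boundaryE[OF sm fr]) (rule that)
    define W where "W = U \<inter> interior (closure \<Omega>)"
    have W: "open W" "p \<in> W"
      using U p by (auto simp: W_def)
    have "frechet_derivative \<rho> (at p) = (\<lambda>v. 0)"
    proof (rule differential_zero_maxmin[OF W(2,1)])
      show "(\<rho> has_derivative frechet_derivative \<rho> (at p)) (at p)"
        using smooth_on_differentiable[OF U(3,2)] frechet_derivative_works by blast
      show "(\<forall>x\<in>W. \<rho> x \<le> \<rho> p) \<or> (\<forall>x\<in>W. \<rho> p \<le> \<rho> x)"
        using nonpos zero interior_subset[of "closure \<Omega>"] by (auto simp: W_def)
    qed
    with nz show False ..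
  qed
qed

section \<open>Boundary points over the unit circle\<close>

text \<open>
  Every direction in which the defining function decreases points into the domain, hence
  towards smaller \<open>|z|\<close>.  So the half-space where the derivative is negative lies in the
  half-space \<open>Re (v\<^sub>1 \<cdot> cnj z) < 0\<close>, which makes the derivative a positive multiple of
  \<open>Re (v\<^sub>1 \<cdot> cnj z)\<close>; the lemma evaluates it at \<open>v = (z, 0)\<close>.
\<close>

lemma radial_derivative_pos:
  fixes \<rho> :: "complex \<times> complex \<Rightarrow> real"
  assumes "open U" "p \<in> U" "\<rho> differentiable at p" "\<rho> p = 0"
    and nz: "frechet_derivative \<rho> (at p) \<noteq> (\<lambda>v. 0)"
    and unit: "norm (fst p) = 1"
    and sub: "\<And>x. x \<in> U \<Longrightarrow> \<rho> x < 0 \<Longrightarrow> norm (fst x) < 1"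
  shows "frechet_derivative \<rho> (at p) (fst p, 0) > 0"
proof -
  let ?L = "frechet_derivative \<rho> (at p)"
  have lin: "linear ?L"
    using assms(3) by (simp add: linear_frechet_derivative)
  have inward: "fst v \<bullet> fst p < 0" if v: "?L v < 0" for v
  proof -
    have "((\<lambda>t. \<rho> (p + t *\<^sub>R v)) has_real_derivative ?L v) (at 0)"
      using has_real_derivative_along_line[of \<rho> p 0 v] assms(3) by simp
    from DERIV_neg_dec_right[OF this v] obtain d
      where d: "d > 0" "\<And>h. 0 < h \<Longrightarrow> h < d \<Longrightarrow> \<rho> (p + h *\<^sub>R v) < 0"
      using assms(4) by auto
    have "((\<lambda>t. p + t *\<^sub>R v) \<longlongrightarrow> p + 0 *\<^sub>R v) (at_right 0)"
      by (intro tendsto_intros)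
    then have "\<forall>\<^sub>F t in at_right 0. p + t *\<^sub>R v \<in> U"
      using assms(1,2) by (intro topological_tendstoD) auto
    then have "\<forall>\<^sub>F t in at_right (0::real). p + t *\<^sub>R v \<in> U \<and> 0 < t \<and> t < d"
      using d(1) by (intro eventually_conj eventually_at_right_less eventually_at_right_real)
        (auto simp: eventually_at_right_field)
    then obtain t where t: "p + t *\<^sub>R v \<in> U" "0 < t" "t < d"
      using eventually_happens' trivial_limit_at_right_real by blast
    have "norm (fst p + t *\<^sub>R fst v) < 1"
      using sub[OF t(1) d(2)[OF t(2,3)]] by simp
    then have "(norm (fst p + t *\<^sub>R fst v))\<^sup>2 < 1"
      by (simp add: power_less_one_iff)
    moreover have "(norm (fst p + t *\<^sub>R fst v))\<^sup>2 =
        1 + 2 * (t * (fst v \<bullet> fst p)) + t\<^sup>2 * (norm (fst v))\<^sup>2"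
      using dot_norm[of "fst p" "t *\<^sub>R fst v"] unit
      by (simp add: inner_commute power_mult_distrib field_simps)
    moreover have "t\<^sup>2 * (norm (fst v))\<^sup>2 \<ge> 0"
      by simp
    ultimately have "t * (fst v \<bullet> fst p) < 0"
      by linarith
    then show ?thesis
      using t(2) by (simp add: mult_less_0_iff)
  qed
  have n: "fst p \<bullet> fst p = 1"
    using unit by (simp add: norm_eq_1)
  have "?L (fst p, 0) \<ge> 0"
    using inward[of "(fst p, 0)"] n by fastforce
  moreover have "?L (fst p, 0) \<noteq> 0"
  proof
    assume z: "?L (fst p, 0) = 0"
    obtain v where "?L v \<noteq> 0"
      using nz by (meson ext)
    then obtain u where u: "?L u < 0"
      using linear_neg[OF lin, of v] by (metis linorder_neqE_linordered_idom neg_less_0_iff_less)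
    \<comment> \<open>a direction of decrease made tangential to \<open>|z| = 1\<close>\<close>
    define w where "w = u - (fst u \<bullet> fst p) *\<^sub>R (fst p, 0::complex)"
    have "?L w < 0"
      using u z by (simp add: w_def linear_diff[OF lin] linear_scale[OF lin] del: scaleR_Pair)
    moreover have "fst w \<bullet> fst p = 0"
      using n by (simp add: w_def inner_diff_left)
    ultimately show False
      using inward by fastforce
  qed
  ultimately show ?thesis
    by simp
qed

text \<open>
  The radial derivative of the defining function stays positive near \<open>p\<close>, so a radial
  contraction strictly decreases the defining function, which is at most \<open>0\<close> on the closure.
\<close>

lemma radial_push_in:
  assumes sm: "smooth_boundary \<Omega>" and sub: "\<And>x. x \<in> \<Omega> \<Longrightarrow> norm (fst x) < 1"
    and p: "p \<in> frontier \<Omega>" "norm (fst p) = 1"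
  obtains e where "e > 0"
    "\<And>x s. x \<in> closure \<Omega> \<Longrightarrow> dist x p < e \<Longrightarrow> 1 - e < s \<Longrightarrow> s < 1 \<Longrightarrow> (of_real s * fst x, snd x) \<in> \<Omega>"
proof -
  obtain U and \<rho> :: "complex \<times> complex \<Rightarrow> real" where U: "open U" "p \<in> U" "smooth_on U \<rho>"
    and nz: "frechet_derivative \<rho> (at p) \<noteq> (\<lambda>v. 0)"
    and zero: "\<rho> p = 0" and eq: "\<Omega> \<inter> U = {x \<in> U. \<rho> x < 0}"
    and nonpos: "\<forall>x \<in> U \<inter> closure \<Omega>. \<rho> x \<le> 0"
    by (rule smooth_boundaryE[OF sm p(1)]) (rule that)
  define D where "D = (\<lambda>x. frechet_derivative \<rho> (at x) (fst x, 0))"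
  have diff: "\<rho> differentiable at x" if "x \<in> U" for x
    using smooth_on_differentiable[OF U(3) that] .
  have "D p > 0"
    unfolding D_def
    by (rule radial_derivative_pos[OF U(1,2) diff[OF U(2)] zero nz p(2)]) (use eq sub in auto)
  \<comment> \<open>smoothness controls the derivative in fixed directions only, so \<open>(fst x, 0)\<close> is expanded
      in the real basis \<open>(1, 0)\<close>, \<open>(\<i>, 0)\<close>\<close>
  have D_eq: "D x = Re (fst x) * frechet_derivative \<rho> (at x) (1, 0)
                  + Im (fst x) * frechet_derivative \<rho> (at x) (\<i>, 0)" if "x \<in> U" for x
  proof -
    have lin: "linear (frechet_derivative \<rho> (at x))"
      using diff[OF that] by (rule linear_frechet_derivative)
    have "(fst x, 0) = Re (fst x) *\<^sub>R (1, 0) + Im (fst x) *\<^sub>R (\<i>, 0::complex)"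
      by (simp add: complex_eq_iff)
    then show ?thesis
      unfolding D_def by (simp only: linear_add[OF lin] linear_scale[OF lin] real_scaleR_def)
  qed
  have "continuous_on U (\<lambda>x. Re (fst x) * frechet_derivative \<rho> (at x) (1, 0)
                  + Im (fst x) * frechet_derivative \<rho> (at x) (\<i>, 0))"
    by (intro continuous_intros smooth_on_continuous_frechet_derivative[OF U(3)])
  then have "continuous_on U D"
    by (rule continuous_on_eq) (simp add: D_eq)
  then have "open (U \<inter> D -` {0<..})"
    using U(1) by (intro continuous_open_preimage) auto
  then obtain d where d: "d > 0" "ball p d \<subseteq> U \<inter> D -` {0<..}"
    using \<open>D p > 0\<close> U(2) openE[of "U \<inter> D -` {0<..}" p] by auto
  show ?thesis
  proof
    show "min (d / 2) 1 > 0"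
      using d(1) by simp
    fix x s assume x: "x \<in> closure \<Omega>" "dist x p < min (d / 2) 1" and s: "1 - min (d / 2) 1 < s" "s < 1"
    define q where "q = (\<lambda>t::real. (0, snd x) + t *\<^sub>R (fst x, 0::complex))"
    have q_eq: "q t = (of_real t * fst x, snd x)" for t
      by (simp add: q_def scaleR_conv_of_real)
    have "\<Omega> \<subseteq> {x. norm (fst x) \<le> 1}"
      using sub by (auto intro: less_imp_le)
    then have "closure \<Omega> \<subseteq> {x. norm (fst x) \<le> 1}"
      by (rule closure_minimal) (intro closed_Collect_le continuous_intros)
    then have "norm (fst x) \<le> 1"
      using x(1) by auto
    have near: "q t \<in> ball p d" if "s \<le> t" "t \<le> 1" for t
    proof -
      have "q t - x = (t - 1) *\<^sub>R (fst x, 0)"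
        by (simp add: q_def prod_eq_iff algebra_simps)
      then have "dist (q t) x = \<bar>t - 1\<bar> * norm (fst x)"
        by (simp add: dist_norm norm_Pair del: scaleR_Pair)
      also have "\<dots> \<le> \<bar>t - 1\<bar> * 1"
        using \<open>norm (fst x) \<le> 1\<close> by (intro mult_left_mono) auto
      also have "\<dots> < d / 2"
        using that s by auto
      finally show ?thesis
        using x(2) dist_triangle[of "q t" p x] by (simp add: dist_commute)
    qed
    have "\<rho> (q s) < \<rho> (q 1)"
    proof (rule DERIV_pos_imp_increasing[OF s(2)])
      fix t assume t: "s \<le> t" "t \<le> 1"
      have "t > 0"
        using t s by auto
      have qt: "q t \<in> U" "D (q t) > 0"
        using near[OF t] d(2) by auto
      let ?L = "frechet_derivative \<rho> (at (q t))"
      have "(fst (q t), 0) = t *\<^sub>R (fst x, 0::complex)"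
        by (simp add: q_def)
      then have "D (q t) = t * ?L (fst x, 0)"
        using linear_scale[OF linear_frechet_derivative[OF diff[OF qt(1)]]]
        by (simp only: D_def real_scaleR_def)
      then have "?L (fst x, 0) > 0"
        using qt(2) \<open>t > 0\<close> by (simp add: zero_less_mult_iff)
      moreover have "((\<lambda>t. \<rho> (q t)) has_real_derivative ?L (fst x, 0)) (at t)"
        unfolding q_def by (rule has_real_derivative_along_line) (use diff[OF qt(1)] q_def in simp)
      ultimately show "\<exists>y. ((\<lambda>t. \<rho> (q t)) has_real_derivative y) (at t) \<and> 0 < y"
        by blast
    qed
    moreover have "\<rho> (q 1) \<le> 0"
    proof -
      have "q 1 = x"
        by (simp add: q_eq)
      moreover have "x \<in> U"
        using near[of 1] s(2) d(2) \<open>q 1 = x\<close> by auto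
      ultimately show ?thesis
        using nonpos x(1) by simp
    qed
    ultimately have "q s \<in> {x \<in> U. \<rho> x < 0}"
      using near[of s] s(2) d(2) by auto
    then have "q s \<in> \<Omega>"
      unfolding eq[symmetric] by simp
    then show "(of_real s * fst x, snd x) \<in> \<Omega>"
      by (simp add: q_eq)
  qed
qed

section \<open>Contracting the closure into the domain\<close>

lemma hartogs_domain_iff:
  "x \<in> hartogs_domain \<psi> \<longleftrightarrow> norm (fst x) < 1 \<and> norm (snd x) < exp (- \<psi> (fst x))"
  by (cases x) (auto simp: hartogs_domain_def)

lemma closure_hartogs_domain_fibre_le:
  assumes "continuous_on (ball 0 1) \<psi>" "x \<in> closure (hartogs_domain \<psi>)" "norm (fst x) < 1"
  shows "norm (snd x) \<le> exp (- \<psi> (fst x))"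
proof -
  obtain X where X: "\<And>n. X n \<in> hartogs_domain \<psi>" "X \<longlonglongrightarrow> x"
    using assms(2) unfolding closure_sequential by blast
  have "isCont \<psi> (fst x)"
    using assms(1,3) by (simp add: continuous_on_eq_continuous_at)
  then have upper: "(\<lambda>n. exp (- \<psi> (fst (X n)))) \<longlonglongrightarrow> exp (- \<psi> (fst x))"
    by (intro tendsto_exp tendsto_minus isCont_tendsto_compose[of _ \<psi>] tendsto_fst X(2))
  have "(\<lambda>n. norm (snd (X n))) \<longlonglongrightarrow> norm (snd x)"
    by (intro tendsto_norm tendsto_snd X(2))
  from this upper show ?thesis
    by (rule LIMSEQ_le) (use X(1) in \<open>auto simp: hartogs_domain_iff intro: less_imp_le\<close>)
qed

text \<open>
  Only near the circle \<open>|z| = 1\<close> does the contraction in \<open>z\<close> help; further inside it might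
  lead out of the domain, which is why the factor \<open>1 / S\<close> is there.  Over the circle that
  factor does no harm because the fibres are discs centred at \<open>0\<close>.
\<close>

lemma closure_pushed_into_hartogs_domain:
  assumes cont: "continuous_on (ball 0 1) \<psi>" and bdd: "bounded (\<psi> ` ball 0 1)"
    and op: "open (hartogs_domain \<psi>)" and sm: "smooth_boundary (hartogs_domain \<psi>)" and "S > 1"
  obtains e where "e > 0"
    "\<And>s x. 1 - e < s \<Longrightarrow> s < 1 \<Longrightarrow> x \<in> closure (hartogs_domain \<psi>) \<Longrightarrow>
       (of_real s * fst x, snd x / of_real S) \<in> hartogs_domain \<psi>"
proof -
  let ?\<Omega> = "hartogs_domain \<psi>"
  let ?f = "\<lambda>s x. (of_real s * fst x, snd x / of_real S) :: complex \<times> complex"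
  have local: "\<exists>e>0. \<forall>x\<in>closure ?\<Omega>. \<forall>s. dist x p < e \<longrightarrow> 1 - e < s \<longrightarrow> s < 1 \<longrightarrow> ?f s x \<in> ?\<Omega>"
    if p: "p \<in> closure ?\<Omega>" for p
  proof (cases "norm (fst p) < 1")
    case True
    have "norm (snd p) / S < exp (- \<psi> (fst p))"
    proof -
      have "norm (snd p) \<le> exp (- \<psi> (fst p))"
        by (rule closure_hartogs_domain_fibre_le[OF cont p True])
      also have "\<dots> < exp (- \<psi> (fst p)) * S"
        using \<open>S > 1\<close> by simp
      finally show ?thesis
        using \<open>S > 1\<close> by (simp add: divide_less_eq)
    qed
    then have in0: "?f 1 p \<in> ?\<Omega>"
      using True \<open>S > 1\<close> by (simp add: hartogs_domain_iff norm_divide)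
    have "open ((\<lambda>y. ?f (fst y) (snd y)) -` ?\<Omega>)"
      using \<open>S > 1\<close> by (intro open_vimage[OF op] continuous_intros) auto
    then obtain d where d: "d > 0" "ball (1, p) d \<subseteq> (\<lambda>y. ?f (fst y) (snd y)) -` ?\<Omega>"
      using in0 openE[of "(\<lambda>y. ?f (fst y) (snd y)) -` ?\<Omega>" "(1, p)"] by auto
    have "?f s x \<in> ?\<Omega>" if "dist x p < d / 2" "1 - d / 2 < s" "s < 1" for x s
    proof -
      have "dist (s, x) (1, p) \<le> dist s 1 + dist x p"
        unfolding dist_Pair_Pair by (rule sqrt_sum_squares_le_sum) auto
      also have "\<dots> < d"
        using that by (simp add: dist_real_def)
      finally show ?thesis
        using subsetD[OF d(2), of "(s, x)"] by (simp add: dist_commute)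
    qed
    then show ?thesis
      using d(1) by (intro exI[of _ "d / 2"]) auto
  next
    case False
    have sub: "norm (fst x) < 1" if "x \<in> ?\<Omega>" for x
      using that by (simp add: hartogs_domain_iff)
    have "closure ?\<Omega> \<subseteq> {x. norm (fst x) \<le> 1}"
      by (rule closure_minimal)
        (use sub in \<open>auto intro!: closed_Collect_le continuous_intros intro: less_imp_le\<close>)
    then have "norm (fst p) = 1"
      using p False by auto
    moreover have "p \<in> frontier ?\<Omega>"
      using p False interior_open[OF op] sub[of p] by (auto simp: frontier_def)
    ultimately obtain e where e: "e > 0"
      "\<And>x s. x \<in> closure ?\<Omega> \<Longrightarrow> dist x p < e \<Longrightarrow> 1 - e < s \<Longrightarrow> s < 1 \<Longrightarrow> (of_real s * fst x, snd x) \<in> ?\<Omega>"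
      using radial_push_in[OF sm sub] by metis
    have "?f s x \<in> ?\<Omega>" if "(of_real s * fst x, snd x) \<in> ?\<Omega>" for x s
    proof -
      have "norm (snd x) \<le> norm (snd x) * S"
        using \<open>S > 1\<close> by (simp add: mult_le_cancel_left1)
      then have "norm (snd x) / S \<le> norm (snd x)"
        using \<open>S > 1\<close> by (simp add: divide_le_eq)
      then show ?thesis
        using that \<open>S > 1\<close> by (simp add: hartogs_domain_iff norm_divide)
    qed
    with e show ?thesis
      by blast
  qed
  then obtain e where e: "\<And>p. p \<in> closure ?\<Omega> \<Longrightarrow> e p > 0"
    "\<And>p x s. p \<in> closure ?\<Omega> \<Longrightarrow> x \<in> closure ?\<Omega> \<Longrightarrow> dist x p < e p \<Longrightarrow> 1 - e p < s \<Longrightarrow> s < 1 \<Longrightarrow> ?f s x \<in> ?\<Omega>"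
    by metis
  have "compact (closure ?\<Omega>)"
    using bounded_hartogs_domain[OF bdd] compact_closure by blast
  moreover have "closure ?\<Omega> \<subseteq> (\<Union>p\<in>closure ?\<Omega>. ball p (e p))"
    using e(1) by fastforce
  ultimately obtain F where F: "F \<subseteq> closure ?\<Omega>" "finite F" "closure ?\<Omega> \<subseteq> (\<Union>p\<in>F. ball p (e p))"
    using compactE_image[of "closure ?\<Omega>" "closure ?\<Omega>" "\<lambda>p. ball p (e p)"] by blast
  show ?thesis
  proof
    \<comment> \<open>the \<open>1\<close> only keeps the minimum meaningful should \<open>F\<close> be empty\<close>
    show "Min (insert 1 (e ` F)) > 0"
      using F e(1) by auto
    fix s x assume s: "1 - Min (insert 1 (e ` F)) < s" "s < 1" and x: "x \<in> closure ?\<Omega>"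
    obtain p where p: "p \<in> F" "dist x p < e p"
      using x F(3) by (auto simp: dist_commute)
    have "Min (insert 1 (e ` F)) \<le> e p"
      using F(2) p(1) by (intro Min_le) auto
    then show "?f s x \<in> ?\<Omega>"
      using e(2)[of p x s] p x s F(1) by auto
  qed
qed

section \<open>The Nebenhuelle\<close>

theorem theorem3:
  fixes \<psi> :: "complex \<Rightarrow> real" and \<Omega> :: "(complex \<times> complex) set"
  assumes "continuous_on (ball 0 1) \<psi>"
    and "bounded (\<psi> ` ball 0 1)"
    and "continuous_subharmonic_on (ball 0 1) \<psi>"
    and "\<Omega> = hartogs_domain \<psi>"
    and "pseudoconvex_domain \<Omega>"
    and "smooth_boundary \<Omega>"
  shows "nebenhuelle \<Omega> = \<Omega> \<and> \<not> has_nontrivial_nebenhuelle \<Omega>"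
proof -
  have op: "open \<Omega>"
    using assms(5) by (simp add: pseudoconvex_domain_def)
  have cpt: "compact (closure \<Omega>)"
    using bounded_hartogs_domain[OF assms(2)] compact_closure assms(4) by blast
  let ?N = "\<Inter>{G. pseudoconvex_domain G \<and> compactly_contained \<Omega> G}"
  have "?N \<subseteq> closure \<Omega>"
  proof
    fix p assume p: "p \<in> ?N"
    have "\<exists>s. 1 - 1 / real (Suc n) < s \<and> s < 1 \<and>
            (of_real s * fst p, snd p / of_real (1 + 1 / real (Suc n))) \<in> \<Omega>" for n
    proof -
      define S where "S = 1 + 1 / real (Suc n)"
      have S: "S > 1"
        by (simp add: S_def)
      obtain e where e: "e > 0"
        "\<And>s x. 1 - e < s \<Longrightarrow> s < 1 \<Longrightarrow> x \<in> closure \<Omega> \<Longrightarrow> (of_real s * fst x, snd x / of_real S) \<in> \<Omega>"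
        using closure_pushed_into_hartogs_domain[OF assms(1,2) _ _ S] op assms(4,6) by metis
      have "max 0 (max (1 - e) (1 - 1 / real (Suc n))) < 1"
        using e(1) by simp
      from dense[OF this] obtain s where s: "0 < s" "1 - e < s" "1 - 1 / real (Suc n) < s" "s < 1"
        by auto
      define f where "f = (\<lambda>x::complex\<times>complex. (of_real (1 / s) * fst x, of_real S * snd x))"
      have mem: "x \<in> f ` \<Omega> \<longleftrightarrow> (of_real s * fst x, snd x / of_real S) \<in> \<Omega>" for x
      proof
        assume "(of_real s * fst x, snd x / of_real S) \<in> \<Omega>"
        moreover have "x = f (of_real s * fst x, snd x / of_real S)"
          using s S by (simp add: f_def)
        ultimately show "x \<in> f ` \<Omega>"
          by blast
      qed (use s S in \<open>auto simp: f_def\<close>)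
      have "pseudoconvex_domain (f ` \<Omega>)"
        unfolding f_def using s S by (intro pseudoconvex_domain_diagonal_image[OF assms(5)]) auto
      moreover have "compactly_contained \<Omega> (f ` \<Omega>)"
        unfolding compactly_contained_def using cpt e(2)[OF s(2,4)] mem by blast
      ultimately have "p \<in> f ` \<Omega>"
        using p by blast
      then show ?thesis
        using mem s by (auto simp: S_def)
    qed
    then obtain s where s: "\<And>n. 1 - 1 / real (Suc n) < s n" "\<And>n. s n < 1"
      "\<And>n. (of_real (s n) * fst p, snd p / of_real (1 + 1 / real (Suc n))) \<in> \<Omega>"
      by metis
    have inv: "(\<lambda>n. 1 / real (Suc n)) \<longlonglongrightarrow> 0"
      using LIMSEQ_inverse_real_of_nat by (simp add: inverse_eq_divide)
    have "s \<longlonglongrightarrow> 1"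
    proof (rule tendsto_sandwich[of "\<lambda>n. 1 - 1 / real (Suc n)" s sequentially "\<lambda>_. 1"])
      show "(\<lambda>n. 1 - 1 / real (Suc n)) \<longlonglongrightarrow> 1"
        using tendsto_diff[OF tendsto_const inv, of 1] by simp
    qed (use s(1,2) in \<open>auto intro: always_eventually less_imp_le\<close>)
    then have "(\<lambda>n. (of_real (s n) * fst p, snd p / of_real (1 + 1 / real (Suc n))))
        \<longlonglongrightarrow> (of_real 1 * fst p, snd p / of_real (1 + 0))"
      by (intro tendsto_intros inv) auto
    then show "p \<in> closure \<Omega>"
      unfolding closure_sequential using s(3) by fastforce
  qed
  then have "nebenhuelle \<Omega> \<subseteq> \<Omega>"
    unfolding nebenhuelle_def
    using interior_mono interior_closure_smooth_boundary[OF op assms(6)] by metis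
  moreover have "\<Omega> \<subseteq> nebenhuelle \<Omega>"
    unfolding nebenhuelle_def
    by (rule interior_maximal[OF _ op]) (use closure_subset in \<open>auto simp: compactly_contained_def\<close>)
  ultimately have "nebenhuelle \<Omega> = \<Omega>"
    by blast
  then show ?thesis
    by (simp add: has_nontrivial_nebenhuelle_def)
qed

end
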